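(* Let $N$ be a positive integer, $\Omega=\{-1,+1\}^N$, $\hat J\in[0,+\infty)$, let $(Y_k)_{k\ge1}$ be the Wolff dynamics on $\Omega$ with coupling constant $\hat J$, and let $\mu_N$ be the Gibbs measure of the one-dimensional periodic Ising model with coupling constant $\hat J$. Then for any initial configuration $Y_1\in\Omega$ and any real-valued function $g$ on $\Omega$, $$\lim_{M\to+\infty}\frac1M\sum_{k=1}^M g(Y_k)=E_{\mu_N}[g],\qquad \mathbb P\text{-a.s.}$$
   Context: Indices in $[N]=\{1,\dots,N\}$ are cyclic ($N+1\equiv1$). The Gibbs measure is $\mu_N(\sigma)=Z_N^{-1}\exp\big(\hat J\sum_{i=1}^N\sigma_i\sigma_{i+1}\big)$ on $\Omega$, with $Z_N$ the normalizing constant; $E_{\mu_N}$ is expectation with respect to $\mu_N$. $G=([N],\mathcal G)$ is the undirected cycle with the $N$ edges $\{i,i+1\}$, $i=1,\dots,N$ (counted with multiplicity if $N=2$). Wolff dynamics: a discrete-time Markov chain $(Y_k)_{k\ge1}$ on $\Omega$, defined on a probability space with measure $\mathbb P$; one step from $\sigma$ is as follows. Choose a site $i_0\in[N]$ uniformly at random and start the cluster with $i_0$. Repeatedly, for each site $i$ in the cluster and each edge joining $i$ to a neighbour $j$ with $\sigma_j=\sigma_i$ such that this edge has not been considered before, add $j$ to the cluster with probability $1-e^{-\hat J(1+\sigma_i\sigma_j)}=1-e^{-2\hat J}$, independently over edges. When no edge remains to be considered, flip all spins of the cluster (with probability 1). Equivalently: declare each edge with aligned endpoint spins open independently with probability $1-e^{-2\hat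 J}$ (all other edges are closed), and flip the open-connected component of $i_0$. *)

theory Defs
  imports "HOL-Probability.Probability"
begin

definition cyc_succ :: "nat \<Rightarrow> nat \<Rightarrow> nat" where
  "cyc_succ N i = i mod N + 1"

definition configs :: "nat \<Rightarrow> (nat \<Rightarrow> int) set" where
  "configs N = {1..N} \<rightarrow>\<^sub>E {-1, 1}"

definition ising_weight :: "nat \<Rightarrow> real \<Rightarrow> (nat \<Rightarrow> int) \<Rightarrow> real" where
  "ising_weight N J \<sigma> = exp (J * (\<Sum>i=1..N. real_of_int (\<sigma> i * \<sigma> (cyc_succ N i))))"

definition partition_function :: "nat \<Rightarrow> real \<Rightarrow> real" where
  "partition_function N J = (\<Sum>\<sigma>\<in>configs N. ising_weight N J \<sigma>)"

definition gibbs_measure :: "nat \<Rightarrow> real \<Rightarrow> (nat \<Rightarrow> int) measure" where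
  "gibbs_measure N J =
     point_measure (configs N) (\<lambda>\<sigma>. ennreal (ising_weight N J \<sigma> / partition_function N J))"

(* Edges of the cycle are named by their index: edge e joins e and cyc_succ N e. Thus N = 2
   has two parallel edges (opened independently of each other), and N = 1 has a single loop. *)

definition edge_law :: "nat \<Rightarrow> real \<Rightarrow> (nat \<Rightarrow> int) \<Rightarrow> (nat \<Rightarrow> bool) pmf" where
  "edge_law N J \<sigma> = Pi_pmf {1..N} False
     (\<lambda>e. bernoulli_pmf (if \<sigma> e = \<sigma> (cyc_succ N e) then 1 - exp (- 2 * J) else 0))"

definition open_adj :: "nat \<Rightarrow> (nat \<Rightarrow> bool) \<Rightarrow> (nat \<times> nat) set" where
  "open_adj N w = {(i, j). \<exists>e\<in>{1..N}. w e \<and> {i, j} = {e, cyc_succ N e}}"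

definition open_cluster :: "nat \<Rightarrow> (nat \<Rightarrow> bool) \<Rightarrow> nat \<Rightarrow> nat set" where
  "open_cluster N w i = {j. (i, j) \<in> (open_adj N w)\<^sup>*}"

definition flip_spins :: "nat set \<Rightarrow> (nat \<Rightarrow> int) \<Rightarrow> (nat \<Rightarrow> int)" where
  "flip_spins C \<sigma> = (\<lambda>i. if i \<in> C then - \<sigma> i else \<sigma> i)"

(* The cluster grown edge by edge from i0 has the law of the open cluster of i0 when all aligned
   edges are opened independently with probability 1 - exp (- 2 * J), misaligned ones staying
   closed. The whole cluster is flipped with probability 1. *)

definition wolff_step :: "nat \<Rightarrow> real \<Rightarrow> (nat \<Rightarrow> int) \<Rightarrow> (nat \<Rightarrow> int) pmf" where
  "wolff_step N J \<sigma> =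
     bind_pmf (pmf_of_set {1..N}) (\<lambda>i0.
       map_pmf (\<lambda>w. flip_spins (open_cluster N w i0) \<sigma>) (edge_law N J \<sigma>))"

(* Time starts at 1; Y 0 is unconstrained. The conditional law is only prescribed given
   histories of positive probability. *)

definition markov_chain ::
    "'a measure \<Rightarrow> 's set \<Rightarrow> ('s \<Rightarrow> 's pmf) \<Rightarrow> (nat \<Rightarrow> 'a \<Rightarrow> 's) \<Rightarrow> bool" where
  "markov_chain P S K Y \<longleftrightarrow>
     prob_space P \<and>
     (\<forall>k\<ge>1. Y k \<in> measurable P (count_space S)) \<and>
     (\<forall>n\<ge>1. \<forall>x. \<forall>y\<in>S. (\<forall>k\<in>{1..n}. x k \<in> S) \<longrightarrow>
        \<P>(\<omega> in P. \<forall>k\<in>{1..n}. Y k \<omega> = x k) > 0 \<longrightarrow>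
        \<P>(\<omega> in P. Y (n + 1) \<omega> = y \<bar> \<forall>k\<in>{1..n}. Y k \<omega> = x k) = pmf (K (x n)) y)"

definition wolff_dynamics :: "nat \<Rightarrow> real \<Rightarrow> 'a measure \<Rightarrow> (nat \<Rightarrow> 'a \<Rightarrow> (nat \<Rightarrow> int)) \<Rightarrow> bool" where
  "wolff_dynamics N J P Y \<longleftrightarrow> markov_chain P (configs N) (wolff_step N J) Y"

end

theory Submission
  imports Defs "HOL-Library.Discrete_Functions"
begin

text \<open>
  The theorem is the ergodic theorem for a finite irreducible Markov chain, together with the facts
  that the Wolff dynamics is irreducible and leaves the Gibbs measure invariant.

  Irreducibility (\<open>wolff_step_irreducible\<close>) holds because with positive probability no edge is
  open, and then a single arbitrary spin is flipped. Invariance (\<open>wolff_step_stationary\<close>) comes from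
  the Edwards--Sokal coupling: the product of the Ising weight of a spin configuration and the
  probability of a set of open edges depends on the spins only through the requirement that open edges
  be aligned (\<open>ising_weight_edge_law\<close>), and flipping a whole open cluster respects this requirement.

  The ergodic theorem has a probabilistic and a deterministic half. For each state \<open>z\<close> the
  differences between the indicator of a jump to \<open>z\<close> and its conditional probability given the past
  are bounded and pairwise orthogonal. Their averages vanish almost surely, by a second moment bound
  along the squares (\<open>strong_law_orthogonal_bounded\<close>). So almost every trajectory has empirical
  transition frequencies that asymptotically agree with the kernel. On any such trajectory the time
  averages of \<open>g\<close> do not change in the limit when \<open>g\<close> is replaced by its conditional expectation a few
  steps of the lazy chain later, and by Doeblin's argument these conditional expectations are
  eventually almost constant, with a value close to the stationary mean of \<open>g\<close>
  (\<open>tendsto_stationary_average\<close>). Working with the lazy chain makes periodicity harmless.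
\<close>

section \<open>Trajectories of a finite irreducible kernel\<close>

text \<open>The average of \<open>f\<close> over one step of the lazy chain, which stays put with probability one
  half. Laziness removes periodicity, and the Wolff dynamics can be periodic: for \<open>N = 1\<close>, or for
  \<open>J = 0\<close>, every step flips exactly one spin.\<close>

definition lazy_average :: "'s set \<Rightarrow> ('s \<Rightarrow> 's pmf) \<Rightarrow> ('s \<Rightarrow> real) \<Rightarrow> 's \<Rightarrow> real" where
  "lazy_average S K f x = (f x + (\<Sum>y\<in>S. pmf (K x) y * f y)) / 2"

locale finite_kernel =
  fixes S :: "'s set" and K :: "'s \<Rightarrow> 's pmf"
  assumes finite_S: "finite S"
    and closed: "\<And>x. x \<in> S \<Longrightarrow> set_pmf (K x) \<subseteq> S"
begin

abbreviation L where "L \<equiv> lazy_average S K"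

lemma lazy_power_Suc:
  "(L ^^ Suc n) f x = ((L ^^ n) f x + (\<Sum>y\<in>S. pmf (K x) y * (L ^^ n) f y)) / 2"
  by (simp add: lazy_average_def[of S K "(L ^^ n) f"])

lemma sum_kernel: "x \<in> S \<Longrightarrow> (\<Sum>y\<in>S. pmf (K x) y) = 1"
  using sum_pmf_eq_1[OF finite_S closed] by simp

lemma lazy_power_affine:
  "x \<in> S \<Longrightarrow> (L ^^ n) (\<lambda>z. c + r * f z) x = c + r * (L ^^ n) f x"
proof (induction n arbitrary: x)
  case (Suc n)
  have "(L ^^ Suc n) (\<lambda>z. c + r * f z) x =
      ((c + r * (L ^^ n) f x) + (\<Sum>y\<in>S. pmf (K x) y * (c + r * (L ^^ n) f y))) / 2"
    unfolding lazy_power_Suc using Suc by simp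
  also have "(\<Sum>y\<in>S. pmf (K x) y * (c + r * (L ^^ n) f y)) =
      c + r * (\<Sum>y\<in>S. pmf (K x) y * (L ^^ n) f y)"
    using sum_kernel[OF Suc.prems]
    by (simp add: distrib_left sum.distrib mult.left_commute[of _ r]
      flip: sum_distrib_left sum_distrib_right)
  finally show ?case
    unfolding lazy_power_Suc by (simp add: field_simps)
qed simp

lemma lazy_power_nonneg:
  assumes "\<forall>z\<in>S. 0 \<le> f z" "x \<in> S" shows "0 \<le> (L ^^ n) f x"
  using assms(2)
proof (induction n arbitrary: x)
  case (Suc n)
  then show ?case
    unfolding lazy_power_Suc by (intro divide_nonneg_pos add_nonneg_nonneg sum_nonneg) auto
qed (use assms in simp)

text \<open>The lazy chain goes from \<open>x\<close> to \<open>y\<close> in \<open>n\<close> steps with probability at least \<open>d\<close>, tested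
  on nonnegative functions so that no iterated kernels are needed.\<close>

definition minorised :: "nat \<Rightarrow> 's \<Rightarrow> 's \<Rightarrow> real \<Rightarrow> bool" where
  "minorised n x y d \<longleftrightarrow> (\<forall>f. (\<forall>z\<in>S. 0 \<le> f z) \<longrightarrow> d * f y \<le> (L ^^ n) f x)"

lemma minorised_step:
  assumes "x \<in> S" "z \<in> S" "minorised n z y d"
  shows "minorised (Suc n) x y (pmf (K x) z * d / 2)"
  unfolding minorised_def
proof (intro allI impI)
  fix f :: "'s \<Rightarrow> real" assume f: "\<forall>z\<in>S. 0 \<le> f z"
  have "pmf (K x) z * d * f y \<le> pmf (K x) z * (L ^^ n) f z"
    using assms(3) f by (simp add: minorised_def mult.assoc mult_left_mono)
  also have "\<dots> \<le> (\<Sum>y\<in>S. pmf (K x) y * (L ^^ n) f y)"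
    using assms f by (intro member_le_sum) (auto simp: finite_S lazy_power_nonneg)
  finally show "pmf (K x) z * d / 2 * f y \<le> (L ^^ Suc n) f x"
    using lazy_power_nonneg[OF f assms(1), of n] unfolding lazy_power_Suc by simp
qed

lemma minorised_lazy:
  assumes "x \<in> S" "minorised n x y d"
  shows "minorised (Suc n) x y (d / 2)"
  unfolding minorised_def
proof (intro allI impI)
  fix f :: "'s \<Rightarrow> real" assume f: "\<forall>z\<in>S. 0 \<le> f z"
  have "0 \<le> (\<Sum>y\<in>S. pmf (K x) y * (L ^^ n) f y)"
    using lazy_power_nonneg[OF f] by (auto intro!: sum_nonneg)
  then show "d / 2 * f y \<le> (L ^^ Suc n) f x"
    using assms(2)[unfolded minorised_def, rule_format, of f] f unfolding lazy_power_Suc by simp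
qed

lemma minorised_of_reachable:
  assumes "(x, y) \<in> {(x, y). x \<in> S \<and> y \<in> S \<and> 0 < pmf (K x) y}\<^sup>*" "x \<in> S"
  shows "\<exists>n. \<exists>d>0. minorised n x y d"
  using assms
proof (induction rule: converse_rtrancl_induct)
  case base
  have "minorised 0 y y 1" by (simp add: minorised_def)
  then show ?case by (metis zero_less_one)
next
  case (step x z)
  then obtain n d where "d > 0" "minorised n z y d" by auto
  with step have "minorised (Suc n) x y (pmf (K x) z * d / 2)" "pmf (K x) z * d / 2 > 0"
    using minorised_step by auto
  then show ?case by blast
qed

end

locale irreducible_kernel = finite_kernel S K for S :: "'s set" and K +
  assumes nonempty: "S \<noteq> {}"
    and irreducible: "\<And>x y. x \<in> S \<Longrightarrow> y \<in> S \<Longrightarrow>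
      (x, y) \<in> {(x, y). x \<in> S \<and> y \<in> S \<and> 0 < pmf (K x) y}\<^sup>*"
begin

text \<open>Doeblin's condition. Each \<open>x\<close> reaches \<open>y\<close> in some number of steps, and by laziness then also
  in any larger number, so that one number serves the finitely many starting points.\<close>

lemma uniform_minorisation:
  assumes "y \<in> S"
  shows "\<exists>n. \<exists>d>0. d \<le> 1 \<and> (\<forall>x\<in>S. minorised n x y d)"
proof -
  have "eventually (\<lambda>n. \<exists>d>0. minorised n x y d) sequentially" if x: "x \<in> S" for x
  proof -
    obtain n d where n: "d > 0" "minorised n x y d"
      using minorised_of_reachable[OF irreducible[OF x assms] x] by blast
    have "\<exists>d>0. minorised m x y d" if "m \<ge> n" for m
      using that
    proof (induction rule: dec_induct)
      case (step m)
      then show ?case using minorised_lazy[OF x] half_gt_zero by blast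
    qed (use n in blast)
    then show ?thesis by (auto simp: eventually_sequentially)
  qed
  then have "eventually (\<lambda>n. \<forall>x\<in>S. \<exists>d>0. minorised n x y d) sequentially"
    using finite_S by (simp add: eventually_ball_finite)
  then obtain n where "\<forall>x\<in>S. \<exists>d>0. minorised n x y d"
    by (auto simp: eventually_sequentially)
  then obtain D where D: "\<And>x. x \<in> S \<Longrightarrow> D x > 0" "\<And>x. x \<in> S \<Longrightarrow> minorised n x y (D x)"
    by metis
  define d where "d = Min (insert 1 (D ` S))"
  have "d > 0" "d \<le> 1" using D finite_S by (auto simp: d_def)
  moreover have "minorised n x y d" if x: "x \<in> S" for x
    unfolding minorised_def
  proof (intro allI impI)
    fix f :: "'s \<Rightarrow> real" assume f: "\<forall>z\<in>S. 0 \<le> f z"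
    have "d \<le> D x" using x finite_S by (auto simp: d_def)
    then have "d * f y \<le> D x * f y" using f assms by (simp add: mult_right_mono)
    also have "\<dots> \<le> (L ^^ n) f x" using D(2)[OF x] f by (simp add: minorised_def)
    finally show "d * f y \<le> (L ^^ n) f x" .
  qed
  ultimately show ?thesis by blast
qed

text \<open>With \<open>n\<close>, \<open>y\<close> and \<open>d\<close> as in Doeblin's condition, all values of \<open>(L ^^ n) f\<close> give weight at
  least \<open>d\<close> to the same number \<open>f y\<close>. Hence \<open>L ^^ n\<close> shrinks any interval containing the values of
  a function by the factor \<open>1 - d\<close>, and iterating makes the interval arbitrarily short.\<close>

lemma lazy_power_contracts:
  assumes "e > 0"
  shows "\<exists>k a b. b - a < e \<and> (\<forall>x\<in>S. a \<le> (L ^^ k) f x \<and> (L ^^ k) f x \<le> b)"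
proof -
  obtain y where y: "y \<in> S" using nonempty by blast
  obtain n d where d: "0 < d" "d \<le> 1" and min: "\<forall>x\<in>S. minorised n x y d"
    using uniform_minorisation[OF y] by blast
  define a0 where "a0 = Min (f ` S)"
  define b0 where "b0 = Max (f ` S)"
  have step: "\<exists>k a b. b - a = (1 - d) ^ j * (b0 - a0) \<and>
      (\<forall>x\<in>S. a \<le> (L ^^ k) f x \<and> (L ^^ k) f x \<le> b)" for j
  proof (induction j)
    case 0
    have "\<forall>x\<in>S. a0 \<le> (L ^^ 0) f x \<and> (L ^^ 0) f x \<le> b0"
      using finite_S by (auto simp: a0_def b0_def)
    then show ?case by (intro exI[of _ 0] exI[of _ a0] exI[of _ b0]) auto
  next
    case (Suc j)
    then obtain k a b where ab: "b - a = (1 - d) ^ j * (b0 - a0)"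
      and range: "\<forall>x\<in>S. a \<le> (L ^^ k) f x \<and> (L ^^ k) f x \<le> b" by blast
    define h where "h = (L ^^ k) f"
    have iter: "(L ^^ (n + k)) f x = (L ^^ n) h x" for x
      by (simp add: h_def funpow_add)
    \<comment> \<open>The minorisation is applied to the nonnegative functions \<open>h - a\<close> and \<open>b - h\<close>.\<close>
    define a' where "a' = a + d * (h y - a)"
    define b' where "b' = b - d * (b - h y)"
    have "a' \<le> (L ^^ n) h x \<and> (L ^^ n) h x \<le> b'" if x: "x \<in> S" for x
    proof -
      have "d * (-a + 1 * h y) \<le> (L ^^ n) (\<lambda>z. -a + 1 * h z) x"
        using min[rule_format, OF x, unfolded minorised_def, rule_format, of "\<lambda>z. -a + 1 * h z"] range
        by (simp add: h_def)
      moreover have "d * (b + (-1) * h y) \<le> (L ^^ n) (\<lambda>z. b + (-1) * h z) x"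
        using min[rule_format, OF x, unfolded minorised_def, rule_format, of "\<lambda>z. b + (-1) * h z"] range
        by (simp add: h_def)
      ultimately show ?thesis
        unfolding lazy_power_affine[OF x] by (simp add: a'_def b'_def algebra_simps)
    qed
    moreover have "b' - a' = (1 - d) * (b - a)" by (simp add: a'_def b'_def algebra_simps)
    then have "b' - a' = (1 - d) ^ Suc j * (b0 - a0)" by (simp add: ab)
    ultimately show ?case using iter by metis
  qed
  have "(\<lambda>j. (1 - d) ^ j * (b0 - a0)) \<longlonglongrightarrow> 0 * (b0 - a0)"
    using d by (intro tendsto_mult LIMSEQ_realpow_zero tendsto_const) auto
  then have "eventually (\<lambda>j. (1 - d) ^ j * (b0 - a0) < e) sequentially"
    using assms by (auto dest: order_tendstoD(2))
  then obtain j where "(1 - d) ^ j * (b0 - a0) < e" by (auto simp: eventually_sequentially)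
  then show ?thesis using step[of j] by metis
qed

text \<open>A deterministic statement about a single trajectory whose empirical transition frequencies
  agree asymptotically with \<open>K\<close>. The time averages of \<open>g\<close> and of \<open>(L ^^ n) g\<close> then differ by
  a null sequence, and the two functions have equal means under the stationary weights \<open>p\<close>. Since
  \<open>(L ^^ n) g\<close> is nearly constant for suitable \<open>n\<close>, the time average of \<open>g\<close> must approach its mean.\<close>

lemma tendsto_stationary_average:
  fixes p :: "'s \<Rightarrow> real" and y :: "nat \<Rightarrow> 's" and g :: "'s \<Rightarrow> real"
  assumes p: "\<And>x. x \<in> S \<Longrightarrow> 0 \<le> p x" "(\<Sum>x\<in>S. p x) = 1"
    and stationary: "\<And>z. z \<in> S \<Longrightarrow> (\<Sum>x\<in>S. p x * pmf (K x) z) = p z"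
    and path: "\<And>k. k \<ge> 1 \<Longrightarrow> y k \<in> S"
    and transitions: "\<And>z. z \<in> S \<Longrightarrow>
      (\<lambda>m. (\<Sum>k=1..m. (if y (k + 1) = z then 1 else 0) - pmf (K (y k)) z) / real m) \<longlonglongrightarrow> 0"
  shows "(\<lambda>m. (\<Sum>k=1..m. g (y k)) / real m) \<longlonglongrightarrow> (\<Sum>x\<in>S. p x * g x)"
proof -
  \<comment> \<open>Stationarity for \<open>K\<close> gives stationarity for the lazy chain.\<close>
  have pL: "(\<Sum>x\<in>S. p x * (L ^^ n) f x) = (\<Sum>x\<in>S. p x * f x)" for f n
  proof (induction n)
    case (Suc n)
    have "(\<Sum>x\<in>S. p x * (\<Sum>z\<in>S. pmf (K x) z * (L ^^ n) f z)) =
        (\<Sum>z\<in>S. (\<Sum>x\<in>S. p x * pmf (K x) z) * (L ^^ n) f z)"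
      unfolding sum_distrib_left sum_distrib_right
      by (subst sum.swap) (simp add: mult.assoc)
    also have "\<dots> = (\<Sum>z\<in>S. p z * (L ^^ n) f z)"
      using stationary by simp
    finally show ?case
      unfolding lazy_power_Suc using Suc by (simp add: add_divide_distrib distrib_left sum.distrib
        flip: sum_divide_distrib)
  qed simp
  \<comment> \<open>Counting visits at time \<open>k\<close> instead of \<open>k + 1\<close> changes the sum by a telescoping, hence
      bounded, amount.\<close>
  have freq: "(\<lambda>m. (\<Sum>k=1..m. (if y k = z then 1 else 0) - pmf (K (y k)) z) / real m) \<longlonglongrightarrow> 0"
    if z: "z \<in> S" for z
  proof -
    define a :: "nat \<Rightarrow> real" where "a = (\<lambda>k. if y k = z then 1 else 0)"
    have telescope: "(\<Sum>k=1..m. (if y k = z then 1 else 0) - pmf (K (y k)) z) =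
        (a 1 - a (m + 1)) + (\<Sum>k=1..m. (if y (k + 1) = z then 1 else 0) - pmf (K (y k)) z)" for m
      by (induction m) (simp_all add: a_def)
    have "\<bar>a 1 - a (m + 1)\<bar> \<le> 1" for m by (simp add: a_def)
    then have "(\<lambda>m. (a 1 - a (m + 1)) / real m) \<longlonglongrightarrow> 0"
      by (intro Lim_null_comparison[OF _ lim_const_over_n[of 1]])
         (auto simp: divide_right_mono)
    from tendsto_add[OF this transitions[OF z]] show ?thesis
      unfolding telescope add_divide_distrib by simp
  qed
  \<comment> \<open>\<open>f - L f\<close> is a combination of the functions whose averages vanish by \<open>freq\<close>.\<close>
  have coboundary: "(\<lambda>m. (\<Sum>k=1..m. f (y k) - L f (y k)) / real m) \<longlonglongrightarrow> 0" for f
  proof -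
    have "f x - L f x = (\<Sum>z\<in>S. f z / 2 * ((if x = z then 1 else 0) - pmf (K x) z))"
      if "x \<in> S" for x
    proof -
      have "(\<Sum>z\<in>S. f z / 2 * (if x = z then 1 else 0)) = f x / 2"
        using that finite_S by (simp add: if_distrib cong: if_cong)
      then show ?thesis
        by (simp only: lazy_average_def right_diff_distrib sum_subtractf)
           (simp add: sum_divide_distrib add_divide_distrib mult.commute)
    qed
    then have "(\<Sum>k=1..m. f (y k) - L f (y k)) / real m =
      (\<Sum>z\<in>S. f z / 2 * ((\<Sum>k=1..m. (if y k = z then 1 else 0) - pmf (K (y k)) z) / real m))" for m
      using path by (simp add: sum_divide_distrib sum_distrib_left sum.swap[of _ _ S])
    moreover have "(\<lambda>m. \<Sum>z\<in>S. f z / 2 * ((\<Sum>k=1..m. (if y k = z then 1 else 0) - pmf (K (y k)) z) / real m))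
        \<longlonglongrightarrow> (\<Sum>z\<in>S. f z / 2 * 0)"
      by (intro tendsto_sum tendsto_mult tendsto_const freq)
    ultimately show ?thesis by simp
  qed
  have iter: "(\<lambda>m. (\<Sum>k=1..m. g (y k) - (L ^^ n) g (y k)) / real m) \<longlonglongrightarrow> 0" for n
  proof (induction n)
    case (Suc n)
    have "(\<lambda>m. (\<Sum>k=1..m. g (y k) - (L ^^ n) g (y k)) / real m +
        (\<Sum>k=1..m. (L ^^ n) g (y k) - L ((L ^^ n) g) (y k)) / real m) \<longlonglongrightarrow> 0 + 0"
      by (intro tendsto_add Suc coboundary)
    then show ?case by (simp flip: add_divide_distrib sum.distrib)
  qed simp
  show ?thesis
  proof (rule tendstoI)
    fix e :: real assume e: "e > 0"
    obtain k a b where ab: "b - a < e / 2"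
      and range: "\<forall>x\<in>S. a \<le> (L ^^ k) g x \<and> (L ^^ k) g x \<le> b"
      using lazy_power_contracts[OF half_gt_zero[OF e], of g] by blast
    define q where "q = (\<Sum>x\<in>S. p x * g x)"
    have "(\<Sum>x\<in>S. p x * a) \<le> q" "q \<le> (\<Sum>x\<in>S. p x * b)"
      unfolding q_def pL[of k g, symmetric]
      by (intro sum_mono mult_left_mono; use range p in auto)+
    then have q: "a \<le> q" "q \<le> b" using p by (simp_all flip: sum_distrib_right)
    have "eventually (\<lambda>m. \<bar>(\<Sum>j=1..m. g (y j) - (L ^^ k) g (y j)) / real m\<bar> < e / 2) sequentially"
      using tendstoD[OF iter[of k], of "e / 2"] e by simp
    then show "eventually (\<lambda>m. dist ((\<Sum>k=1..m. g (y k)) / real m) (\<Sum>x\<in>S. p x * g x) < e) sequentially"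
      using eventually_gt_at_top[of 0]
    proof eventually_elim
      case (elim m)
      have "(\<Sum>j=1..m. a) \<le> (\<Sum>j=1..m. (L ^^ k) g (y j))"
        "(\<Sum>j=1..m. (L ^^ k) g (y j)) \<le> (\<Sum>j=1..m. b)"
        by (intro sum_mono; use range path in auto)+
      then have "a \<le> (\<Sum>j=1..m. (L ^^ k) g (y j)) / real m"
        "(\<Sum>j=1..m. (L ^^ k) g (y j)) / real m \<le> b"
        using elim by (simp_all add: field_simps)
      then show ?case
        using elim(1) q ab
        unfolding dist_real_def q_def[symmetric] sum_subtractf diff_divide_distrib by linarith
    qed
  qed
qed

end

section \<open>A strong law for bounded orthogonal variables\<close>

text \<open>Between consecutive squares \<open>n\<^sup>2\<close> and \<open>(n + 1)\<^sup>2\<close> the partial sums move by at most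
  \<open>2 * n\<close>, which is negligible compared with \<open>n\<^sup>2\<close>.\<close>

lemma tendsto_average_of_squares:
  fixes D :: "nat \<Rightarrow> real"
  assumes bound: "\<And>k. k \<ge> 1 \<Longrightarrow> \<bar>D k\<bar> \<le> 1"
    and squares: "(\<lambda>n. (\<Sum>k=1..n\<^sup>2. D k) / real (n\<^sup>2)) \<longlonglongrightarrow> 0"
  shows "(\<lambda>m. (\<Sum>k=1..m. D k) / real m) \<longlonglongrightarrow> 0"
proof -
  define S where "S = (\<lambda>m. \<Sum>k=1..m. D k)"
  have lim: "filterlim floor_sqrt at_top at_top"
    unfolding filterlim_at_top
  proof
    fix z :: nat
    have "z \<le> floor_sqrt m" if "m \<ge> z\<^sup>2" for m
      using mono_floor_sqrt'[OF that] by simp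
    then show "eventually (\<lambda>m. z \<le> floor_sqrt m) at_top"
      unfolding eventually_at_top_linorder by blast
  qed
  have "(\<lambda>n. \<bar>S (n\<^sup>2) / real (n\<^sup>2)\<bar> + 2 / real n) \<longlonglongrightarrow> \<bar>0\<bar> + 0"
    using squares unfolding S_def by (intro tendsto_add tendsto_rabs lim_const_over_n)
  from filterlim_compose[OF this lim]
  have lim': "(\<lambda>m. \<bar>S ((floor_sqrt m)\<^sup>2) / real ((floor_sqrt m)\<^sup>2)\<bar> + 2 / real (floor_sqrt m)) \<longlonglongrightarrow> 0"
    by simp
  have "eventually (\<lambda>m. norm (S m / real m) \<le>
      \<bar>S ((floor_sqrt m)\<^sup>2) / real ((floor_sqrt m)\<^sup>2)\<bar> + 2 / real (floor_sqrt m)) sequentially"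
    using eventually_gt_at_top[of 0]
  proof eventually_elim
    case (elim m)
    define n where "n = floor_sqrt m"
    have n: "n > 0" "n\<^sup>2 \<le> m" using elim by (simp_all add: n_def)
    have "m < (Suc n)\<^sup>2"
      using Suc_floor_sqrt_power2_gt[of m] by (simp add: n_def)
    then have gap: "m - n\<^sup>2 \<le> 2 * n" by (simp add: power2_eq_square)
    have "{1..m} = {1..n\<^sup>2} \<union> {n\<^sup>2<..m}" using n by auto
    then have "S m = S (n\<^sup>2) + (\<Sum>k\<in>{n\<^sup>2<..m}. D k)"
      unfolding S_def by simp (subst sum.union_disjoint, auto)
    moreover have "\<bar>\<Sum>k\<in>{n\<^sup>2<..m}. D k\<bar> \<le> (\<Sum>k\<in>{n\<^sup>2<..m}. 1)"
      by (rule order_trans[OF sum_abs], intro sum_mono bound) (use n in auto)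
    moreover have "(\<Sum>k\<in>{n\<^sup>2<..m}. 1::real) \<le> 2 * real n"
      using gap by simp
    ultimately have "\<bar>S m\<bar> \<le> \<bar>S (n\<^sup>2)\<bar> + 2 * real n" by linarith
    then have "\<bar>S m\<bar> / real m \<le> (\<bar>S (n\<^sup>2)\<bar> + 2 * real n) / real (n\<^sup>2)"
      using n by (intro frac_le) (auto simp flip: of_nat_power)
    also have "\<dots> = \<bar>S (n\<^sup>2) / real (n\<^sup>2)\<bar> + 2 / real n"
      using n by (simp add: field_simps power2_eq_square)
    finally show ?case by (simp add: n_def)
  qed
  from Lim_null_comparison[OF this lim'] show ?thesis by (simp add: S_def)
qed

context prob_space
begin

lemma second_moment_orthogonal_sum:
  fixes D :: "nat \<Rightarrow> 'a \<Rightarrow> real"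
  assumes rv: "\<And>k. k \<ge> 1 \<Longrightarrow> random_variable borel (D k)"
    and bound: "\<And>k \<omega>. k \<ge> 1 \<Longrightarrow> \<omega> \<in> space M \<Longrightarrow> \<bar>D k \<omega>\<bar> \<le> 1"
    and orth: "\<And>i j. 1 \<le> i \<Longrightarrow> i < j \<Longrightarrow> expectation (\<lambda>\<omega>. D i \<omega> * D j \<omega>) = 0"
  shows "integrable M (\<lambda>\<omega>. (\<Sum>k=1..m. D k \<omega>)\<^sup>2) \<and> expectation (\<lambda>\<omega>. (\<Sum>k=1..m. D k \<omega>)\<^sup>2) \<le> real m"
proof (induction m)
  case (Suc m)
  have int: "integrable M (\<lambda>\<omega>. D i \<omega> * D j \<omega>)" if "i \<ge> 1" "j \<ge> 1" for i j
    using rv[OF that(1)] rv[OF that(2)] bound[OF that(1)] bound[OF that(2)]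
    by (intro integrable_const_bound[where B = 1])
       (auto simp: abs_mult intro!: AE_I2 mult_le_one)
  have eq: "(\<Sum>k=1..Suc m. D k \<omega>)\<^sup>2 =
      (\<Sum>k=1..m. D k \<omega>)\<^sup>2 + 2 * (\<Sum>k=1..m. D k \<omega> * D (Suc m) \<omega>) + D (Suc m) \<omega> * D (Suc m) \<omega>" for \<omega>
    by (simp add: power2_eq_square algebra_simps flip: sum_distrib_left sum_distrib_right)
  have int_cross: "integrable M (\<lambda>\<omega>. \<Sum>k=1..m. D k \<omega> * D (Suc m) \<omega>)"
    by (intro Bochner_Integration.integrable_sum int) auto
  have cross: "expectation (\<lambda>\<omega>. \<Sum>k=1..m. D k \<omega> * D (Suc m) \<omega>) = 0"
    by (subst Bochner_Integration.integral_sum) (auto intro!: int sum.neutral orth)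
  have "D (Suc m) \<omega> * D (Suc m) \<omega> \<le> 1" if "\<omega> \<in> space M" for \<omega>
    using bound[of "Suc m" \<omega>] that by (simp add: abs_square_le_1 flip: power2_eq_square)
  then have "expectation (\<lambda>\<omega>. D (Suc m) \<omega> * D (Suc m) \<omega>) \<le> 1"
    by (intro integral_le_const int) (auto intro: AE_I2)
  then show ?case
    unfolding eq using Suc int_cross cross int[of "Suc m" "Suc m"] by simp
qed simp

text \<open>The averages over \<open>n\<^sup>2\<close> terms have second moment at most \<open>1 / n\<^sup>2\<close>. These bounds are
  summable, so almost surely the squared averages are summable as well and tend to \<open>0\<close> along the
  squares.\<close>

lemma strong_law_orthogonal_bounded:
  fixes D :: "nat \<Rightarrow> 'a \<Rightarrow> real"
  assumes rv: "\<And>k. k \<ge> 1 \<Longrightarrow> random_variable borel (D k)"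
    and bound: "\<And>k \<omega>. k \<ge> 1 \<Longrightarrow> \<omega> \<in> space M \<Longrightarrow> \<bar>D k \<omega>\<bar> \<le> 1"
    and orth: "\<And>i j. 1 \<le> i \<Longrightarrow> i < j \<Longrightarrow> expectation (\<lambda>\<omega>. D i \<omega> * D j \<omega>) = 0"
  shows "AE \<omega> in M. (\<lambda>m. (\<Sum>k=1..m. D k \<omega>) / real m) \<longlonglongrightarrow> 0"
proof -
  define Z where "Z = (\<lambda>n \<omega>. ((\<Sum>k=1..n\<^sup>2. D k \<omega>) / real (n\<^sup>2))\<^sup>2)"
  have Z_moment: "(\<integral>\<^sup>+\<omega>. ennreal (Z n \<omega>) \<partial>M) \<le> ennreal (1 / real n ^ 2)" for n
  proof -
    note moment = second_moment_orthogonal_sum[OF assms, where m = "n\<^sup>2"]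
    have Z: "Z n \<omega> = (\<Sum>k=1..n\<^sup>2. D k \<omega>)\<^sup>2 / real (n\<^sup>2) ^ 2" for \<omega>
      by (simp add: Z_def power_divide)
    have "(\<integral>\<^sup>+\<omega>. ennreal (Z n \<omega>) \<partial>M) = ennreal (expectation (Z n))"
      using moment unfolding Z by (intro nn_integral_eq_integral) auto
    also have "expectation (Z n) \<le> real (n\<^sup>2) / real (n\<^sup>2) ^ 2"
      using moment unfolding Z by (simp add: divide_right_mono)
    also have "real (n\<^sup>2) / real (n\<^sup>2) ^ 2 = 1 / real n ^ 2"
      by (simp add: power2_eq_square)
    finally show ?thesis by (simp add: ennreal_leI)
  qed
  have meas: "(\<lambda>\<omega>. ennreal (Z n \<omega>)) \<in> borel_measurable M" for n
    using rv unfolding Z_def by (intro measurable_compose[OF _ measurable_ennreal]) 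
      (auto intro!: borel_measurable_power borel_measurable_divide borel_measurable_sum)
  have "(\<integral>\<^sup>+\<omega>. (\<Sum>n. ennreal (Z n \<omega>)) \<partial>M) = (\<Sum>n. \<integral>\<^sup>+\<omega>. ennreal (Z n \<omega>) \<partial>M)"
    by (intro nn_integral_suminf meas)
  also have "\<dots> \<le> (\<Sum>n. ennreal (1 / real n ^ 2))"
    by (intro suminf_le Z_moment) auto
  also have "\<dots> = ennreal (\<Sum>n. 1 / real n ^ 2)"
    using inverse_power_summable[of 2, where 'a = real]
    by (intro suminf_ennreal2) (auto simp: inverse_eq_divide)
  also have "\<dots> < \<infinity>" by simp
  finally have "AE \<omega> in M. (\<Sum>n. ennreal (Z n \<omega>)) \<noteq> \<infinity>"
    using meas by (intro nn_integral_PInf_AE) auto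
  then show ?thesis
    using AE_space
  proof eventually_elim
    case (elim \<omega>)
    have "summable (\<lambda>n. Z n \<omega>)"
      using elim(1) by (intro summable_suminf_not_top) (auto simp: Z_def)
    then have "(\<lambda>n. Z n \<omega>) \<longlonglongrightarrow> 0" by (rule summable_LIMSEQ_zero)
    then have "(\<lambda>n. sqrt (Z n \<omega>)) \<longlonglongrightarrow> 0" by (auto dest: tendsto_real_sqrt)
    then have "(\<lambda>n. (\<Sum>k=1..n\<^sup>2. D k \<omega>) / real (n\<^sup>2)) \<longlonglongrightarrow> 0"
      unfolding Z_def real_sqrt_abs by (simp only: tendsto_rabs_zero_iff)
    then show ?case
      by (intro tendsto_average_of_squares bound elim)
  qed
qed

end

section \<open>Transition frequencies of a Markov chain\<close>

definition transition_residual ::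
  "('s \<Rightarrow> 's pmf) \<Rightarrow> (nat \<Rightarrow> 'a \<Rightarrow> 's) \<Rightarrow> 's \<Rightarrow> nat \<Rightarrow> 'a \<Rightarrow> real" where
  "transition_residual K Y z k \<omega> = (if Y (k + 1) \<omega> = z then 1 else 0) - pmf (K (Y k \<omega>)) z"

lemma abs_transition_residual: "\<bar>transition_residual K Y z k \<omega>\<bar> \<le> 1"
  using pmf_le_1[of "K (Y k \<omega>)" z]
  by (auto simp: transition_residual_def indicator_def)

lemma transition_residual_measurable:
  assumes "markov_chain P S K Y" "k \<ge> 1"
  shows "transition_residual K Y z k \<in> borel_measurable P"
proof -
  have Y: "Y k \<in> measurable P (count_space S)" "Y (k + 1) \<in> measurable P (count_space S)"
    using assms by (auto simp: markov_chain_def)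
  show ?thesis unfolding transition_residual_def
    by (intro borel_measurable_diff measurable_compose[OF Y(1)] measurable_compose[OF Y(2), of "\<lambda>s. if s = z then 1 else 0"]) auto
qed

text \<open>The law of the chain is prescribed through conditional probabilities given histories; these
  are the events conditioned upon.\<close>

lemma history_measurable:
  assumes "markov_chain P S K Y"
  shows "{\<omega> \<in> space P. \<forall>k\<in>{1..n}. Y k \<omega> = x k} \<in> sets P"
proof -
  have "{\<omega> \<in> space P. Y k \<omega> = x k} \<in> sets P" if "k \<in> {1..n}" for k
  proof -
    have Y: "Y k \<in> measurable P (count_space S)"
      using that assms by (auto simp: markov_chain_def)
    have "{\<omega> \<in> space P. Y k \<omega> = x k} = Y k -` ({x k} \<inter> S) \<inter> space P"
      using measurable_space[OF Y] by auto
    then show ?thesis using measurable_sets[OF Y, of "{x k} \<inter> S"] by simp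
  qed
  then show ?thesis by (intro sets.sets_Collect_finite_All) auto
qed

text \<open>The martingale difference property. A history of probability \<open>0\<close>, for which no transition
  probabilities are prescribed, contributes nothing to the integral.\<close>

lemma transition_residual_given_history:
  assumes mc: "markov_chain P S K Y" and n: "n \<ge> 1" and z: "z \<in> S"
    and x: "\<And>k. k \<in> {1..n} \<Longrightarrow> x k \<in> S"
  shows "(\<integral>\<omega>. indicator {\<omega> \<in> space P. \<forall>k\<in>{1..n}. Y k \<omega> = x k} \<omega> * transition_residual K Y z n \<omega> \<partial>P) = 0"
proof -
  interpret prob_space P using mc by (simp add: markov_chain_def)
  define H where "H = {\<omega> \<in> space P. \<forall>k\<in>{1..n}. Y k \<omega> = x k}"
  have H: "H \<in> events" unfolding H_def by (rule history_measurable[OF mc])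
  have Y: "Y (n + 1) \<in> measurable P (count_space S)"
    using mc by (auto simp: markov_chain_def)
  define E where "E = Y (n + 1) -` {z} \<inter> space P"
  have E: "E \<in> events" unfolding E_def using z by (intro measurable_sets[OF Y]) auto
  have "indicator H \<omega> * transition_residual K Y z n \<omega> =
      indicator (E \<inter> H) \<omega> - pmf (K (x n)) z * indicator H \<omega>" for \<omega>
    using n by (auto simp: H_def E_def transition_residual_def indicator_def)
  then have "(\<integral>\<omega>. indicator H \<omega> * transition_residual K Y z n \<omega> \<partial>P) =
      prob (E \<inter> H) - pmf (K (x n)) z * prob H"
    using E H by (simp add: less_top[symmetric])
  also have "prob (E \<inter> H) = pmf (K (x n)) z * prob H"
  proof (cases "prob H > 0")
    case True
    have "\<P>(\<omega> in P. Y (n + 1) \<omega> = z \<bar> \<forall>k\<in>{1..n}. Y k \<omega> = x k) = pmf (K (x n)) z"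
      using mc n x z True by (simp add: markov_chain_def H_def)
    moreover have "\<P>(\<omega> in P. Y (n + 1) \<omega> = z \<bar> \<forall>k\<in>{1..n}. Y k \<omega> = x k) = prob (E \<inter> H) / prob H"
      unfolding cond_prob_def H_def E_def by (intro arg_cong2[where f = "(/)"] arg_cong[where f = prob]) auto
    ultimately show ?thesis using True by (simp add: field_simps)
  next
    case False
    then have "prob H = 0" using measure_nonneg[of P H] by linarith
    then show ?thesis
      using finite_measure_mono[of "E \<inter> H" H] H measure_nonneg[of P "E \<inter> H"] by simp
  qed
  finally show ?thesis by (simp add: H_def)
qed

text \<open>The residual at the earlier time \<open>i\<close> is a function of the history up to time \<open>j\<close>, and there
  are only finitely many such histories to sum over.\<close>

lemma transition_residual_orthogonal:
  assumes mc: "markov_chain P S K Y" and fin: "finite S" and z: "z \<in> S" and ij: "1 \<le> i" "i < j"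
  shows "(\<integral>\<omega>. transition_residual K Y z i \<omega> * transition_residual K Y z j \<omega> \<partial>P) = 0"
proof -
  interpret prob_space P using mc by (simp add: markov_chain_def)
  define X where "X = {1..j} \<rightarrow>\<^sub>E S"
  define H where "H = (\<lambda>x. {\<omega> \<in> space P. \<forall>k\<in>{1..j}. Y k \<omega> = x k})"
  \<comment> \<open>The residual at time \<open>i\<close>, read off from a history \<open>x\<close>.\<close>
  define past where "past = (\<lambda>x. (if x (i + 1) = z then 1 else 0) - pmf (K (x i)) z)"
  have finX: "finite X" unfolding X_def using fin by (intro finite_PiE) auto
  have Y: "Y k \<omega> \<in> S" if "\<omega> \<in> space P" "k \<ge> 1" for k \<omega>
    using mc that measurable_space[of "Y k" P "count_space S" \<omega>] by (simp add: markov_chain_def)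
  have decomp: "transition_residual K Y z i \<omega> * transition_residual K Y z j \<omega> =
     (\<Sum>x\<in>X. past x * (indicator (H x) \<omega> * transition_residual K Y z j \<omega>))" if \<omega>: "\<omega> \<in> space P" for \<omega>
  proof -
    define h where "h = (\<lambda>k\<in>{1..j}. Y k \<omega>)"
    have h: "h \<in> X" using Y[OF \<omega>] by (auto simp: h_def X_def)
    have "\<omega> \<in> H x \<longleftrightarrow> x = h" if "x \<in> X" for x
    proof
      assume "\<omega> \<in> H x"
      then show "x = h"
        using PiE_ext[OF that[unfolded X_def] h[unfolded X_def]] by (simp add: H_def h_def)
    qed (use \<omega> in \<open>simp add: H_def h_def\<close>)
    then have "(\<Sum>x\<in>X. past x * (indicator (H x) \<omega> * transition_residual K Y z j \<omega>)) =
        (\<Sum>x\<in>X. if x = h then past x * transition_residual K Y z j \<omega> else 0)"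
      by (intro sum.cong) (auto simp: indicator_def)
    also have "\<dots> = past h * transition_residual K Y z j \<omega>" using finX h by simp
    also have "past h = transition_residual K Y z i \<omega>"
      using ij by (simp add: past_def h_def transition_residual_def)
    finally show ?thesis by simp
  qed
  have int: "integrable P (\<lambda>\<omega>. indicator (H x) \<omega> * transition_residual K Y z j \<omega>)" for x
    using transition_residual_measurable[OF mc, of j z] history_measurable[OF mc, of j x] ij
      abs_transition_residual[of K Y z j]
    by (intro integrable_const_bound[where B = 1]) (auto simp: H_def indicator_def)
  have "(\<integral>\<omega>. transition_residual K Y z i \<omega> * transition_residual K Y z j \<omega> \<partial>P) =
      (\<integral>\<omega>. (\<Sum>x\<in>X. past x * (indicator (H x) \<omega> * transition_residual K Y z j \<omega>)) \<partial>P)"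
    by (intro Bochner_Integration.integral_cong refl decomp)
  also have "\<dots> = (\<Sum>x\<in>X. past x * (\<integral>\<omega>. indicator (H x) \<omega> * transition_residual K Y z j \<omega> \<partial>P))"
    using int by simp
  also have "\<dots> = 0"
    unfolding H_def using ij
    by (intro sum.neutral ballI)
       (subst transition_residual_given_history[OF mc _ z], auto simp: X_def)
  finally show ?thesis .
qed

lemma markov_chain_residual_law:
  assumes "markov_chain P S K Y" "finite S"
  shows "AE \<omega> in P. \<forall>z\<in>S. (\<lambda>m. (\<Sum>k=1..m. transition_residual K Y z k \<omega>) / real m) \<longlonglongrightarrow> 0"
proof -
  interpret prob_space P using assms by (simp add: markov_chain_def)
  show ?thesis
    using assms transition_residual_measurable[OF assms(1)] transition_residual_orthogonal[OF assms]
    by (intro AE_finite_allI strong_law_orthogonal_bounded) (auto simp: abs_transition_residual)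
qed

text \<open>Almost every trajectory has the right transition frequencies for all states at once, because
  there are finitely many states, so the deterministic statement applies to it.\<close>

lemma markov_chain_ergodic:
  fixes g :: "'s \<Rightarrow> real"
  assumes mc: "markov_chain P S K Y" and irr: "irreducible_kernel S K"
    and p: "\<And>x. x \<in> S \<Longrightarrow> 0 \<le> p x" "(\<Sum>x\<in>S. p x) = 1"
    and stationary: "\<And>z. z \<in> S \<Longrightarrow> (\<Sum>x\<in>S. p x * pmf (K x) z) = p z"
  shows "AE \<omega> in P. (\<lambda>m. (\<Sum>k=1..m. g (Y k \<omega>)) / real m) \<longlonglongrightarrow> (\<Sum>x\<in>S. p x * g x)"
proof -
  interpret irreducible_kernel S K by (rule irr)
  show ?thesis
    using markov_chain_residual_law[OF mc finite_S] AE_space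
  proof eventually_elim
    case (elim \<omega>)
    show ?case
    proof (intro tendsto_stationary_average p stationary)
      show "Y k \<omega> \<in> S" if "k \<ge> 1" for k
        using mc that elim(2) measurable_space[of "Y k" P "count_space S" \<omega>]
        by (simp add: markov_chain_def)
    qed (use elim(1) in \<open>simp_all add: transition_residual_def\<close>)
  qed
qed

section \<open>Wolff dynamics and the Edwards--Sokal coupling\<close>

lemma finite_configs: "finite (configs N)"
  by (simp add: configs_def finite_PiE)

lemma cyc_succ_in: "N \<ge> 1 \<Longrightarrow> cyc_succ N e \<in> {1..N}"
  by (simp add: cyc_succ_def Suc_leI)

lemma open_cluster_subset:
  assumes "N \<ge> 1" "i \<in> {1..N}" shows "open_cluster N w i \<subseteq> {1..N}"
proof
  fix j assume "j \<in> open_cluster N w i"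
  then have "(i, j) \<in> (open_adj N w)\<^sup>*" by (simp add: open_cluster_def)
  then show "j \<in> {1..N}"
  proof (induction)
    case (step y z)
    then obtain e where "e \<in> {1..N}" "{y, z} = {e, cyc_succ N e}"
      by (auto simp: open_adj_def)
    then show ?case using cyc_succ_in[OF assms(1), of e] by (auto simp: doubleton_eq_iff)
  qed (use assms in simp)
qed

lemma flip_spins_in_configs:
  assumes "C \<subseteq> {1..N}" "\<sigma> \<in> configs N" shows "flip_spins C \<sigma> \<in> configs N"
  using assms by (auto simp: configs_def flip_spins_def PiE_iff extensional_def)

lemma flip_spins_involution: "flip_spins C (flip_spins C \<sigma>) = \<sigma>"
  by (auto simp: flip_spins_def)

lemma open_edge_same_cluster:
  assumes "e \<in> {1..N}" "w e"
  shows "e \<in> open_cluster N w i \<longleftrightarrow> cyc_succ N e \<in> open_cluster N w i"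
proof -
  have "(e, cyc_succ N e) \<in> open_adj N w" "(cyc_succ N e, e) \<in> open_adj N w"
    using assms by (auto simp: open_adj_def)
  then show ?thesis by (auto simp: open_cluster_def intro: rtrancl_into_rtrancl)
qed

definition edge_configs :: "nat \<Rightarrow> (nat \<Rightarrow> bool) set" where
  "edge_configs N = PiE_dflt {1..N} False (\<lambda>_. UNIV)"

lemma finite_edge_configs: "finite (edge_configs N)"
  unfolding edge_configs_def by (intro finite_PiE_dflt) auto

lemma set_edge_law: "set_pmf (edge_law N J \<sigma>) \<subseteq> edge_configs N"
  using set_Pi_pmf_subset'[of "{1..N}"] by (force simp: edge_law_def edge_configs_def PiE_dflt_def)

text \<open>The Edwards--Sokal coupling: the unnormalised joint weight of spins and open edges.\<close>

definition joint_weight :: "nat \<Rightarrow> real \<Rightarrow> (nat \<Rightarrow> int) \<Rightarrow> (nat \<Rightarrow> bool) \<Rightarrow> real" where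
  "joint_weight N J \<sigma> w = (\<Prod>e\<in>{1..N}.
     if w e then (if \<sigma> e = \<sigma> (cyc_succ N e) then exp J - exp (- J) else 0) else exp (- J))"

text \<open>An edge contributes \<open>exp J\<close> or \<open>exp (- J)\<close> to the Ising weight according to whether its
  endpoints are aligned. An aligned edge is closed with probability \<open>exp (- 2 * J)\<close> and a misaligned
  one with probability \<open>1\<close>, so that a closed edge has total weight \<open>exp (- J)\<close> in both cases. This
  balance is what determines the opening probability \<open>1 - exp (- 2 * J)\<close>.\<close>

lemma ising_weight_edge_law:
  assumes "N \<ge> 1" "J \<ge> 0" "\<sigma> \<in> configs N" "w \<in> edge_configs N"
  shows "ising_weight N J \<sigma> * pmf (edge_law N J \<sigma>) w = joint_weight N J \<sigma> w"
proof -
  have "ising_weight N J \<sigma> = (\<Prod>e\<in>{1..N}. exp (J * (\<sigma> e * \<sigma> (cyc_succ N e))))"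
    by (simp add: ising_weight_def sum_distrib_left exp_sum)
  moreover have "pmf (edge_law N J \<sigma>) w = (\<Prod>e\<in>{1..N}. pmf (bernoulli_pmf
      (if \<sigma> e = \<sigma> (cyc_succ N e) then 1 - exp (- 2 * J) else 0)) (w e))"
    using assms(4) unfolding edge_law_def
    by (subst pmf_Pi') (auto simp: edge_configs_def PiE_dflt_def)
  moreover have "exp (J * (\<sigma> e * \<sigma> (cyc_succ N e))) * pmf (bernoulli_pmf
      (if \<sigma> e = \<sigma> (cyc_succ N e) then 1 - exp (- 2 * J) else 0)) (w e) =
      (if w e then (if \<sigma> e = \<sigma> (cyc_succ N e) then exp J - exp (- J) else 0) else exp (- J))"
    if e: "e \<in> {1..N}" for e
  proof -
    have "\<sigma> e \<in> {-1, 1}" "\<sigma> (cyc_succ N e) \<in> {-1, 1}"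
      using assms(3) e cyc_succ_in[OF assms(1), of e] unfolding configs_def by blast+
    then have "\<sigma> e * \<sigma> (cyc_succ N e) = (if \<sigma> e = \<sigma> (cyc_succ N e) then 1 else -1)"
      by auto
    moreover have "exp J * exp (- (2 * J)) = exp (- J)" by (simp flip: exp_add)
    moreover have "exp (- (2 * J)) \<le> 1" using assms(2) by simp
    ultimately show ?thesis
      by (cases "w e"; cases "\<sigma> e = \<sigma> (cyc_succ N e)") (auto simp: right_diff_distrib)
  qed
  ultimately show ?thesis
    unfolding joint_weight_def by (simp flip: prod.distrib)
qed

text \<open>The joint weight depends on the spins only through the alignment of open edges, and an open
  edge has both endpoints inside a cluster or both outside.\<close>

lemma joint_weight_flip_cluster:
  "joint_weight N J (flip_spins (open_cluster N w i) \<sigma>) w = joint_weight N J \<sigma> w"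
  unfolding joint_weight_def
proof (intro prod.cong refl)
  fix e assume e: "e \<in> {1..N}"
  show "(if w e then (if flip_spins (open_cluster N w i) \<sigma> e = flip_spins (open_cluster N w i) \<sigma> (cyc_succ N e)
        then exp J - exp (- J) else 0) else exp (- J)) =
      (if w e then (if \<sigma> e = \<sigma> (cyc_succ N e) then exp J - exp (- J) else 0) else exp (- J))"
    using open_edge_same_cluster[OF e, of w i] by (auto simp: flip_spins_def)
qed

lemma pmf_wolff_step:
  assumes "N \<ge> 1"
  shows "pmf (wolff_step N J \<sigma>) \<tau> = (\<Sum>i=1..N. \<Sum>w\<in>edge_configs N.
     pmf (edge_law N J \<sigma>) w * (if flip_spins (open_cluster N w i) \<sigma> = \<tau> then 1 else 0)) / real N"
proof -
  have "pmf (map_pmf (\<lambda>w. flip_spins (open_cluster N w i) \<sigma>) (edge_law N J \<sigma>)) \<tau> =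
     (\<Sum>w\<in>edge_configs N. pmf (edge_law N J \<sigma>) w * (if flip_spins (open_cluster N w i) \<sigma> = \<tau> then 1 else 0))" for i
    unfolding map_pmf_def pmf_bind
    by (subst integral_measure_pmf_real[OF finite_edge_configs])
       (use set_edge_law in \<open>auto simp: indicator_def pmf_return mult.commute intro!: sum.cong\<close>)
  then show ?thesis
    using assms unfolding wolff_step_def pmf_bind
    by (subst integral_pmf_of_set) auto
qed

text \<open>For a fixed seed \<open>i\<close> and a fixed set \<open>w\<close> of open edges, the step is an involution of the spin
  configurations that preserves the joint weight. Summing over \<open>w\<close> and averaging over \<open>i\<close> turns
  this into stationarity of the Ising weight.\<close>

lemma wolff_step_stationary:
  assumes "N \<ge> 1" "J \<ge> 0" "\<tau> \<in> configs N"
  shows "(\<Sum>\<sigma>\<in>configs N. ising_weight N J \<sigma> * pmf (wolff_step N J \<sigma>) \<tau>) = ising_weight N J \<tau>"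
proof -
  have flipped: "(\<Sum>\<sigma>\<in>configs N. if flip_spins (open_cluster N w i) \<sigma> = \<tau> then joint_weight N J \<sigma> w else 0) =
      joint_weight N J \<tau> w" if i: "i \<in> {1..N}" for i w
  proof -
    define \<tau>' where "\<tau>' = flip_spins (open_cluster N w i) \<tau>"
    have "flip_spins (open_cluster N w i) \<sigma> = \<tau> \<longleftrightarrow> \<sigma> = \<tau>'" for \<sigma>
      by (metis \<tau>'_def flip_spins_involution)
    moreover have "\<tau>' \<in> configs N"
      unfolding \<tau>'_def by (intro flip_spins_in_configs open_cluster_subset assms i)
    ultimately show ?thesis
      using finite_configs by (simp add: \<tau>'_def joint_weight_flip_cluster)
  qed
  have "(\<Sum>\<sigma>\<in>configs N. ising_weight N J \<sigma> * pmf (wolff_step N J \<sigma>) \<tau>) =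
     (\<Sum>\<sigma>\<in>configs N. \<Sum>i=1..N. \<Sum>w\<in>edge_configs N.
       (if flip_spins (open_cluster N w i) \<sigma> = \<tau> then joint_weight N J \<sigma> w else 0)) / real N"
    unfolding pmf_wolff_step[OF assms(1)] sum_divide_distrib sum_distrib_left
    by (intro sum.cong refl) (auto simp: ising_weight_edge_law[OF assms(1,2), symmetric])
  also have "\<dots> = (\<Sum>i=1..N. \<Sum>w\<in>edge_configs N. \<Sum>\<sigma>\<in>configs N.
       (if flip_spins (open_cluster N w i) \<sigma> = \<tau> then joint_weight N J \<sigma> w else 0)) / real N"
    by (subst sum.swap, subst (2) sum.swap) simp
  also have "\<dots> = (\<Sum>i=1..N. \<Sum>w\<in>edge_configs N. joint_weight N J \<tau> w) / real N"
    using flipped by simp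
  also have "\<dots> = (\<Sum>w\<in>edge_configs N. ising_weight N J \<tau> * pmf (edge_law N J \<tau>) w)"
    using assms by (simp add: ising_weight_edge_law)
  also have "\<dots> = ising_weight N J \<tau>"
    using sum_pmf_eq_1[OF finite_edge_configs set_edge_law]
    by (simp flip: sum_distrib_left)
  finally show ?thesis .
qed

lemma set_wolff_step:
  assumes "N \<ge> 1" "\<sigma> \<in> configs N"
  shows "set_pmf (wolff_step N J \<sigma>) \<subseteq> configs N"
proof
  fix \<tau> assume "\<tau> \<in> set_pmf (wolff_step N J \<sigma>)"
  then obtain i w where "i \<in> {1..N}" "\<tau> = flip_spins (open_cluster N w i) \<sigma>"
    using assms(1) by (auto simp: wolff_step_def)
  then show "\<tau> \<in> configs N"
    using flip_spins_in_configs[OF open_cluster_subset[OF assms(1)] assms(2)] by simp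
qed

text \<open>All edges are closed with positive probability, also when all spins are aligned, because
  \<open>1 - exp (- 2 * J) < 1\<close>; the cluster is then the seed alone.\<close>

lemma wolff_step_single_flip:
  assumes "N \<ge> 1" "J \<ge> 0" "i \<in> {1..N}"
  shows "0 < pmf (wolff_step N J \<sigma>) (flip_spins {i} \<sigma>)"
proof -
  define w0 :: "nat \<Rightarrow> bool" where "w0 = (\<lambda>_. False)"
  have "open_cluster N w0 i = {i}"
    by (simp add: open_cluster_def open_adj_def w0_def)
  moreover have "pmf (edge_law N J \<sigma>) w0 > 0"
    unfolding edge_law_def using assms(2)
    by (subst pmf_Pi') (auto simp: w0_def intro!: prod_pos)
  then have "w0 \<in> set_pmf (edge_law N J \<sigma>)" by (simp add: set_pmf_iff)
  ultimately have "flip_spins {i} \<sigma> \<in>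
      set_pmf (map_pmf (\<lambda>w. flip_spins (open_cluster N w i) \<sigma>) (edge_law N J \<sigma>))"
    by (metis (mono_tags, lifting) image_eqI set_map_pmf)
  then have "flip_spins {i} \<sigma> \<in> set_pmf (wolff_step N J \<sigma>)"
    unfolding wolff_step_def set_bind_pmf using assms(1,3) by (intro UN_I[of i]) auto
  then show ?thesis by (simp add: pmf_positive)
qed

lemma wolff_step_irreducible:
  assumes N: "N \<ge> 1" and J: "J \<ge> 0" and "\<sigma> \<in> configs N" and \<tau>: "\<tau> \<in> configs N"
  shows "(\<sigma>, \<tau>) \<in> {(x, y). x \<in> configs N \<and> y \<in> configs N \<and> 0 < pmf (wolff_step N J x) y}\<^sup>*"
  using assms(3)
proof (induction "card {i \<in> {1..N}. \<sigma> i \<noteq> \<tau> i}" arbitrary: \<sigma>)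
  case 0
  then have "\<forall>i\<in>{1..N}. \<sigma> i = \<tau> i" by auto
  then have "\<sigma> = \<tau>" using 0 \<tau> by (auto simp: configs_def intro: PiE_ext)
  then show ?case by simp
next
  case (Suc n)
  then obtain i where i: "i \<in> {1..N}" "\<sigma> i \<noteq> \<tau> i"
    by (metis (mono_tags, lifting) card.empty empty_Collect_eq nat.distinct(1))
  define \<rho> where "\<rho> = flip_spins {i} \<sigma>"
  have \<rho>: "\<rho> \<in> configs N"
    using i Suc.prems by (auto simp: \<rho>_def intro!: flip_spins_in_configs)
  have "\<sigma> i \<in> {-1, 1}" "\<tau> i \<in> {-1, 1}"
    using i \<tau> Suc.prems unfolding configs_def by blast+
  then have "{j \<in> {1..N}. \<rho> j \<noteq> \<tau> j} = {j \<in> {1..N}. \<sigma> j \<noteq> \<tau> j} - {i}"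
    using i by (auto simp: \<rho>_def flip_spins_def)
  then have "n = card {j \<in> {1..N}. \<rho> j \<noteq> \<tau> j}"
    using Suc.hyps(2) i by simp
  note rest = Suc.hyps(1)[OF this \<rho>]
  have "(\<sigma>, \<rho>) \<in> {(x, y). x \<in> configs N \<and> y \<in> configs N \<and> 0 < pmf (wolff_step N J x) y}"
    using wolff_step_single_flip[OF N J i(1), of \<sigma>] Suc.prems \<rho> by (simp add: \<rho>_def)
  then show ?case using rest by (rule converse_rtrancl_into_rtrancl)
qed

lemma partition_function_pos: "0 < partition_function N J"
proof -
  have "(\<lambda>i\<in>{1..N}. 1) \<in> configs N" by (auto simp: configs_def)
  then show ?thesis
    unfolding partition_function_def
    by (intro sum_pos finite_configs) (auto simp: ising_weight_def)
qed

lemma integral_gibbs_measure: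
  "(\<integral>\<sigma>. g \<sigma> \<partial>gibbs_measure N J) =
     (\<Sum>\<sigma>\<in>configs N. ising_weight N J \<sigma> / partition_function N J * g \<sigma>)" for g :: "_ \<Rightarrow> real"
  unfolding gibbs_measure_def using partition_function_pos[of N J]
  by (subst lebesgue_integral_point_measure_finite)
     (auto simp: finite_configs ising_weight_def)

theorem theorem3p4:
  fixes N :: nat and J :: real and P :: "'a measure"
    and Y :: "nat \<Rightarrow> 'a \<Rightarrow> (nat \<Rightarrow> int)"
    and \<sigma>0 :: "nat \<Rightarrow> int" and g :: "(nat \<Rightarrow> int) \<Rightarrow> real"
  assumes "N \<ge> 1" and "J \<ge> 0"
    and "wolff_dynamics N J P Y"
    and "\<sigma>0 \<in> configs N" and "AE \<omega> in P. Y 1 \<omega> = \<sigma>0"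
  shows "AE \<omega> in P. (\<lambda>m. (1 / real m) * (\<Sum>k=1..m. g (Y k \<omega>)))
           \<longlonglongrightarrow> (\<integral>\<sigma>. g \<sigma> \<partial>gibbs_measure N J)"
proof -
  have "irreducible_kernel (configs N) (wolff_step N J)"
    using assms(4) finite_configs set_wolff_step[OF assms(1)] wolff_step_irreducible[OF assms(1,2)]
    by unfold_locales auto
  moreover have "(\<Sum>\<sigma>\<in>configs N. ising_weight N J \<sigma> / partition_function N J) = 1"
    using partition_function_pos[of N J]
    by (simp add: partition_function_def flip: sum_divide_distrib)
  moreover have "0 \<le> ising_weight N J \<sigma> / partition_function N J" for \<sigma>
    using partition_function_pos[of N J] by (simp add: ising_weight_def)
  moreover have "(\<Sum>\<sigma>\<in>configs N. ising_weight N J \<sigma> / partition_function N J * pmf (wolff_step N J \<sigma>) \<tau>) =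
      ising_weight N J \<tau> / partition_function N J" if "\<tau> \<in> configs N" for \<tau>
    using wolff_step_stationary[OF assms(1,2) that] by (simp flip: sum_divide_distrib)
  ultimately have "AE \<omega> in P. (\<lambda>m. (\<Sum>k=1..m. g (Y k \<omega>)) / real m)
      \<longlonglongrightarrow> (\<Sum>\<sigma>\<in>configs N. ising_weight N J \<sigma> / partition_function N J * g \<sigma>)"
    using assms(3) unfolding wolff_dynamics_def by (intro markov_chain_ergodic)
  then show ?thesis by (simp add: integral_gibbs_measure)
qed

end
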